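(* Let $G$ and $H$ be finite, simple, connected graphs. Then $\dim_f(G\Box H)\geq \dim_f(G)$.
   Context: The cartesian product $G\Box H$ has vertex set $V(G)\times V(H)$, with $(u_1,v_1)$ adjacent to $(u_2,v_2)$ iff either $u_1=u_2$ and $v_1v_2\in E(H)$, or $v_1=v_2$ and $u_1u_2\in E(G)$. For vertices $x,y$ of a connected graph $G$, $R\{x,y\}$ is the set of $z$ with $d(x,z)\neq d(y,z)$. A resolving function of $G$ is $f:V(G)\to[0,1]$ with $\sum_{z\in R\{x,y\}}f(z)\geq 1$ for all distinct $x,y$; $\dim_f(G)$ is the minimum of $\sum_{v\in V(G)}f(v)$ over all resolving functions. *)

theory Defs
  imports "HOL-Analysis.Analysis" "Graph_Theory.Graph_Theory"
begin

text \<open>Finite simple graphs are the pair graphs of the library: finite, symmetric, loop-free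
  arc sets over an explicit vertex set.\<close>

definition cartesian_product ::
    "'a pair_pre_digraph \<Rightarrow> 'b pair_pre_digraph \<Rightarrow> ('a \<times> 'b) pair_pre_digraph" where
  "cartesian_product G H =
     \<lparr> pverts = pverts G \<times> pverts H,
       parcs = {((u1, v1), (u2, v2)) | u1 v1 u2 v2.
         (u1 = u2 \<and> u1 \<in> pverts G \<and> (v1, v2) \<in> parcs H) \<or>
         (v1 = v2 \<and> v1 \<in> pverts H \<and> (u1, u2) \<in> parcs G)} \<rparr>"

text \<open>Every arc has weight 1, so the cost of a walk is its length.\<close>

definition gdist :: "'a pair_pre_digraph \<Rightarrow> 'a \<Rightarrow> 'a \<Rightarrow> ereal" where
  "gdist G x y = wf_digraph.\<mu> (with_proj G) (\<lambda>_. 1) x y"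

definition resolving_set :: "'a pair_pre_digraph \<Rightarrow> 'a \<Rightarrow> 'a \<Rightarrow> 'a set" where
  "resolving_set G x y = {z \<in> pverts G. gdist G x z \<noteq> gdist G y z}"

text \<open>Only the values on the vertex set matter; nothing is required of the function elsewhere.\<close>

definition resolving_function :: "'a pair_pre_digraph \<Rightarrow> ('a \<Rightarrow> real) \<Rightarrow> bool" where
  "resolving_function G f \<longleftrightarrow>
     f \<in> pverts G \<rightarrow> {0..1} \<and>
     (\<forall>x\<in>pverts G. \<forall>y\<in>pverts G. x \<noteq> y \<longrightarrow> (\<Sum>z\<in>resolving_set G x y. f z) \<ge> 1)"

text \<open>The minimum is attained for every finite simple graph: see
  \<open>fractional_metric_dimension_attained\<close> below.\<close>

definition fractional_metric_dimension :: "'a pair_pre_digraph \<Rightarrow> real" where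
  "fractional_metric_dimension G =
     (LEAST s. \<exists>f. resolving_function G f \<and> s = (\<Sum>v\<in>pverts G. f v))"

lemma pair_graph_cartesian_product:
  assumes "pair_graph G" "pair_graph H"
  shows "pair_graph (cartesian_product G H)"
proof -
  interpret G: pair_graph G by fact
  interpret H: pair_graph H by fact
  have sub: "parcs (cartesian_product G H) \<subseteq> (pverts G \<times> pverts H) \<times> (pverts G \<times> pverts H)"
    by (auto simp: cartesian_product_def G.arc_fst_in_verts G.arc_snd_in_verts
        H.arc_fst_in_verts H.arc_snd_in_verts dest: G.in_arcsD1 G.in_arcsD2 H.in_arcsD1 H.in_arcsD2)
  show ?thesis
  proof
    show "finite (pverts (cartesian_product G H))"
      by (simp add: cartesian_product_def)
    show "finite (parcs (cartesian_product G H))"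
      using finite_subset[OF sub] by simp
    show "symmetric (with_proj (cartesian_product G H))"
      unfolding symmetric_def with_proj_simps
      by (rule symI) (auto simp: cartesian_product_def intro: G.arcs_symmetric H.arcs_symmetric)
  next
    fix e assume "e \<in> parcs (cartesian_product G H)"
    then have "e \<in> (pverts G \<times> pverts H) \<times> (pverts G \<times> pverts H)"
      using sub by blast
    then show "fst e \<in> pverts (cartesian_product G H)"
      and "snd e \<in> pverts (cartesian_product G H)"
      by (auto simp: cartesian_product_def)
  next
    fix e assume "e \<in> parcs (cartesian_product G H)"
    then show "fst e \<noteq> snd e"
      using G.pair_no_loops H.pair_no_loops by (fastforce simp: cartesian_product_def)
  qed
qed

lemma gdist_self:
  assumes "pair_graph G" "x \<in> pverts G"
  shows "gdist G x x = 0"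
proof -
  interpret pair_graph G by fact
  have "\<mu> (\<lambda>_. 1) x x \<le> awalk_cost (\<lambda>_. 1) []"
    using assms(2) by (intro min_cost_le_walk_cost) (simp add: awalk_Nil_iff)
  moreover have "0 \<le> \<mu> (\<lambda>_. 1) x x"
    unfolding \<mu>_def by (intro INF_greatest) (auto intro: pos_cost_pos_awalk_cost)
  ultimately show ?thesis by (simp add: gdist_def zero_ereal_def)
qed

lemma gdist_eq_0_imp:
  assumes "pair_graph G" "gdist G x y = 0"
  shows "x = y"
proof (rule ccontr)
  interpret pair_graph G by fact
  assume "x \<noteq> y"
  have "1 \<le> \<mu> (\<lambda>_. 1) x y"
    unfolding \<mu>_def
  proof (intro INF_greatest)
    fix p assume "p \<in> {p. awalk x p y}"
    with \<open>x \<noteq> y\<close> obtain e q where p: "p = e # q" by (cases p) (auto simp: awalk_Nil_iff)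
    have "0 \<le> awalk_cost (\<lambda>_. 1) q"
      by (simp add: awalk_cost_def sum_list_triv)
    then show "1 \<le> ereal (awalk_cost (\<lambda>_. 1) p)"
      by (simp add: p awalk_cost_def one_ereal_def)
  qed
  with assms(2) show False by (simp add: gdist_def)
qed

lemma resolving_function_one:
  assumes "pair_graph G"
  shows "resolving_function G (\<lambda>_. 1)"
proof -
  interpret pair_graph G by fact
  have "1 \<le> (\<Sum>z\<in>resolving_set G x y. 1::real)"
    if "x \<in> pverts G" "y \<in> pverts G" "x \<noteq> y" for x y
  proof -
    have "gdist G y x \<noteq> 0" using gdist_eq_0_imp[OF assms, of y x] that(3) by auto
    then have "x \<in> resolving_set G x y"
      using that gdist_self[OF assms that(1)] by (simp add: resolving_set_def)
    moreover have "finite (resolving_set G x y)"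
      by (simp add: resolving_set_def)
    ultimately have "card (resolving_set G x y) > 0" by (auto simp: card_gt_0_iff)
    then show ?thesis by simp
  qed
  then show ?thesis by (auto simp: resolving_function_def)
qed

lemma fractional_metric_dimension_attained:
  assumes "pair_graph G"
  obtains f where "resolving_function G f"
    "fractional_metric_dimension G = (\<Sum>v\<in>pverts G. f v)"
    "\<And>g. resolving_function G g \<Longrightarrow> fractional_metric_dimension G \<le> (\<Sum>v\<in>pverts G. g v)"
proof -
  interpret pair_graph G by fact
  let ?w = "\<lambda>f. \<Sum>v\<in>pverts G. f v :: real"
  define B where "B = Pi\<^sub>E UNIV (\<lambda>v. if v \<in> pverts G then {0..1::real} else {0})"
  define C where "C = (\<Inter>x\<in>pverts G. \<Inter>y\<in>pverts G - {x}. {f :: _ \<Rightarrow> real. 1 \<le> sum f (resolving_set G x y)})"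
  have cont: "continuous_on UNIV (\<lambda>f :: _ \<Rightarrow> real. sum f A)" for A
    by (intro continuous_on_sum continuous_on_product_coordinates)
  have "compact B"
    unfolding B_def compactin_euclidean_iff[symmetric] euclidean_product_topology[symmetric]
    by (subst compactin_PiE) auto
  moreover have "closed C"
    unfolding C_def by (intro closed_INT ballI closed_Collect_le cont continuous_on_const)
  ultimately have "compact (B \<inter> C)" by (rule compact_Int_closed)
  have BC: "resolving_function G f" if "f \<in> B \<inter> C" for f
  proof -
    have "f v \<in> {0..1}" if "v \<in> pverts G" for v
      using \<open>f \<in> B \<inter> C\<close> that by (auto simp: B_def PiE_iff split: if_splits)
    moreover have "1 \<le> sum f (resolving_set G x y)"
      if "x \<in> pverts G" "y \<in> pverts G" "x \<noteq> y" for x y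
      using \<open>f \<in> B \<inter> C\<close> that unfolding C_def by blast
    ultimately show ?thesis by (auto simp: resolving_function_def)
  qed
  define r where "r g = (\<lambda>v. if v \<in> pverts G then g v else 0 :: real)" for g
  have sum_r: "sum (r g) A = sum g A" if "A \<subseteq> pverts G" for g A
    by (rule sum.cong) (use that in \<open>auto simp: r_def\<close>)
  have r_in: "r g \<in> B \<inter> C" if "resolving_function G g" for g
  proof -
    have "r g \<in> B"
      using that by (auto simp: resolving_function_def B_def r_def PiE_iff Pi_iff)
    moreover have "sum (r g) (resolving_set G x y) = sum g (resolving_set G x y)" for x y
      by (rule sum_r) (auto simp: resolving_set_def)
    then have "r g \<in> C"
      using that by (auto simp: resolving_function_def C_def)
    ultimately show ?thesis by simp
  qed
  have "B \<inter> C \<noteq> {}" using r_in[OF resolving_function_one[OF assms]] by blast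
  then obtain f where f: "f \<in> B \<inter> C" "\<forall>g\<in>B \<inter> C. ?w f \<le> ?w g"
    using continuous_attains_inf[OF \<open>compact (B \<inter> C)\<close> _ continuous_on_subset[OF cont]] by blast
  have min: "?w f \<le> ?w g" if "resolving_function G g" for g
    using bspec[OF f(2) r_in[OF that]] unfolding sum_r[OF subset_refl] .
  have "fractional_metric_dimension G = ?w f"
    unfolding fractional_metric_dimension_def
    by (rule Least_equality) (use BC[OF f(1)] min in auto)
  then show thesis using that[OF BC[OF f(1)]] min by simp
qed

end

theory Submission
  imports Defs
begin

text \<open>Distances add along the two factors of a product, so \<open>(x, h)\<close> and \<open>(y, h)\<close> are resolved only
  by vertices whose first coordinate resolves \<open>x\<close> and \<open>y\<close>. Summing a resolving function of the
  product over the fibres of the first projection, and cutting the sums off at 1, therefore gives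
  a resolving function of the first factor of no larger weight.\<close>

lemma pverts_cartesian_product [simp]:
  "pverts (cartesian_product G H) = pverts G \<times> pverts H"
  by (simp add: cartesian_product_def)

lemma parcs_cartesian_product_iff [simp]:
  "((u1, v1), (u2, v2)) \<in> parcs (cartesian_product G H) \<longleftrightarrow>
     u1 = u2 \<and> u1 \<in> pverts G \<and> (v1, v2) \<in> parcs H \<or>
     v1 = v2 \<and> v1 \<in> pverts H \<and> (u1, u2) \<in> parcs G"
  by (simp add: cartesian_product_def)

text \<open>Unit weights turn the cost of a walk into its length. The infimum lives in
  \<open>ereal\<close>, so vertices joined by no walk are at distance
  \<open>\<infinity>\<close>.\<close>

lemma gdist_eq_INF_length:
  assumes "wf_digraph (with_proj G)"
  shows "gdist G x y = (INF p\<in>{p. pre_digraph.awalk (with_proj G) x p y}. ereal (real (length p)))"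
  using assms by (simp add: gdist_def wf_digraph.\<mu>_def wf_digraph.awalk_cost_def sum_list_triv)

lemma gdist_le_length:
  assumes "wf_digraph (with_proj G)" "pre_digraph.awalk (with_proj G) x p y"
  shows "gdist G x y \<le> real (length p)"
  unfolding gdist_eq_INF_length[OF assms(1)] using assms(2) by (intro INF_lower) simp

lemma gdist_nonneg:
  assumes "wf_digraph (with_proj G)"
  shows "0 \<le> gdist G x y"
  unfolding gdist_eq_INF_length[OF assms] by (intro INF_greatest) simp

text \<open>The walk is copied into the layer at height \<open>h\<close>, since each arc
  \<open>(a, b)\<close> of \<open>G\<close> gives an arc from \<open>(a, h)\<close> to
  \<open>(b, h)\<close>. Together with its counterpart for \<open>H\<close> this bounds product
  distances from above.\<close>

lemma awalk_cartesian_product_fst: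
  assumes "pair_graph G" "pair_graph H" "h \<in> pverts H"
    and "pre_digraph.awalk (with_proj G) x p z"
  shows "pre_digraph.awalk (with_proj (cartesian_product G H))
    (x, h) (map (\<lambda>(a, b). ((a, h), (b, h))) p) (z, h)"
proof -
  interpret G: pair_graph G by fact
  interpret P: pair_graph "cartesian_product G H"
    using assms by (intro pair_graph_cartesian_product)
  show ?thesis
    using assms(4)
  proof (induction p arbitrary: x)
    case Nil
    then show ?case
      using assms(3) by (auto simp: G.awalk_Nil_iff P.awalk_Nil_iff)
  next
    case (Cons e p)
    then show ?case
      using assms(3) by (cases e) (auto simp: G.awalk_Cons_iff P.awalk_Cons_iff)
  qed
qed

lemma awalk_cartesian_product_snd:
  assumes "pair_graph G" "pair_graph H" "x \<in> pverts G"
    and "pre_digraph.awalk (with_proj H) h q w"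
  shows "pre_digraph.awalk (with_proj (cartesian_product G H))
    (x, h) (map (\<lambda>(a, b). ((x, a), (x, b))) q) (x, w)"
proof -
  interpret H: pair_graph H by fact
  interpret P: pair_graph "cartesian_product G H"
    using assms by (intro pair_graph_cartesian_product)
  show ?thesis
    using assms(4)
  proof (induction q arbitrary: h)
    case Nil
    then show ?case
      using assms(3) by (auto simp: H.awalk_Nil_iff P.awalk_Nil_iff)
  next
    case (Cons e q)
    then show ?case
      using assms(3) by (cases e) (auto simp: H.awalk_Cons_iff P.awalk_Cons_iff)
  qed
qed

text \<open>Each arc of the product moves exactly one coordinate, so it is charged to one factor
  while the walk in the other factor stays as it is. This bounds product distances from
  below.\<close>

lemma awalk_cartesian_product_project:
  assumes "pair_graph G" "pair_graph H"
    and "pre_digraph.awalk (with_proj (cartesian_product G H)) (x, h) r (z, w)"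
  obtains p q where "pre_digraph.awalk (with_proj G) x p z"
    "pre_digraph.awalk (with_proj H) h q w" "length p + length q = length r"
proof -
  interpret G: pair_graph G by fact
  interpret H: pair_graph H by fact
  interpret P: pair_graph "cartesian_product G H"
    using assms by (intro pair_graph_cartesian_product)
  have "\<exists>p q. G.awalk x p z \<and> H.awalk h q w \<and> length p + length q = length r"
    using assms(3)
  proof (induction r arbitrary: x h)
    case Nil
    then show ?case
      by (auto simp: P.awalk_Nil_iff G.awalk_Nil_iff H.awalk_Nil_iff)
  next
    case (Cons e r)
    obtain x' h' where e: "e = ((x, h), (x', h'))"
      using Cons.prems by (cases e) (auto simp: P.awalk_Cons_iff)
    have arc: "x = x' \<and> (h, h') \<in> parcs H \<or> h = h' \<and> (x, x') \<in> parcs G"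
      using Cons.prems by (auto simp: P.awalk_Cons_iff e)
    have "P.awalk (x', h') r (z, w)"
      using Cons.prems by (simp add: P.awalk_Cons_iff e)
    from Cons.IH[OF this] obtain p q
      where pq: "G.awalk x' p z" "H.awalk h' q w" "length p + length q = length r"
      by blast
    from arc show ?case
    proof
      assume "x = x' \<and> (h, h') \<in> parcs H"
      with pq have "G.awalk x p z \<and> H.awalk h ((h, h') # q) w
          \<and> length p + length ((h, h') # q) = length (e # r)"
        by (simp add: H.awalk_Cons_iff)
      then show ?thesis by blast
    next
      assume "h = h' \<and> (x, x') \<in> parcs G"
      with pq have "G.awalk x ((x, x') # p) z \<and> H.awalk h q w
          \<and> length ((x, x') # p) + length q = length (e # r)"
        by (simp add: G.awalk_Cons_iff)
      then show ?thesis by blast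
    qed
  qed
  then show thesis using that by blast
qed

lemma gdist_cartesian_product:
  assumes "pair_graph G" "pair_graph H"
  shows "gdist (cartesian_product G H) (x, h) (z, w) = gdist G x z + gdist H h w"
proof -
  interpret G: pair_graph G by fact
  interpret H: pair_graph H by fact
  interpret P: pair_graph "cartesian_product G H"
    using assms by (rule pair_graph_cartesian_product)
  let ?d = "gdist (cartesian_product G H) (x, h) (z, w)"
  note wf = G.wf_digraph_axioms H.wf_digraph_axioms P.wf_digraph_axioms
  show ?thesis
  proof (rule antisym)
    have le: "?d \<le> ereal (length p) + ereal (length q)"
      if "G.awalk x p z" "H.awalk h q w" for p q
    proof -
      have "h \<in> pverts H" "z \<in> pverts G"
        using that by auto
      \<comment> \<open>Walk first inside the layer of \<open>h\<close> to the corner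
        \<open>(z, h)\<close>, then inside the copy of \<open>H\<close> above
        \<open>z\<close>.\<close>
      then have "P.awalk (x, h) (map (\<lambda>(a, b). ((a, h), (b, h))) p
          @ map (\<lambda>(a, b). ((z, a), (z, b))) q) (z, w)"
        using that assms
        by (intro P.awalk_appendI[where v="(z, h)"] awalk_cartesian_product_fst
            awalk_cartesian_product_snd)
      from gdist_le_length[OF wf(3) this] show ?thesis by simp
    qed
    show "?d \<le> gdist G x z + gdist H h w"
    proof (cases "(\<exists>p. G.awalk x p z) \<and> (\<exists>q. H.awalk h q w)")
      case True
      then have ne: "{p. G.awalk x p z} \<noteq> {}" "{q. H.awalk h q w} \<noteq> {}" by auto
      \<comment> \<open>The two infima are taken one at a time, over \<open>q\<close> for a fixed
        \<open>p\<close> and then over \<open>p\<close>. Pulling an infimum out of a sum needs the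
        nonempty index sets \<open>ne\<close> and a constant summand other than
        \<open>-\<infinity>\<close>; for the second infimum \<open>gdist_nonneg\<close> excludes
        that value.\<close>
      have "?d \<le> ereal (length p) + gdist H h w" if "G.awalk x p z" for p
        unfolding gdist_eq_INF_length[OF wf(2)]
        by (subst INF_ereal_add_right[symmetric]) (use ne le that in \<open>auto intro!: INF_greatest\<close>)
      then show ?thesis
        unfolding gdist_eq_INF_length[OF wf(1)] using gdist_nonneg[OF wf(2), of h w]
        by (subst INF_ereal_add_left[symmetric]) (use ne in \<open>auto intro!: INF_greatest\<close>)
    next
      case False
      \<comment> \<open>A factor without a walk contributes the infimum of the empty set, which
        makes the upper bound trivial.\<close>
      then have "gdist G x z = \<infinity> \<or> gdist H h w = \<infinity>"
        by (auto simp: gdist_eq_INF_length[OF wf(1)] gdist_eq_INF_length[OF wf(2)]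
            top_ereal_def)
      then show ?thesis by auto
    qed
  next
    show "gdist G x z + gdist H h w \<le> ?d"
      unfolding gdist_eq_INF_length[OF wf(3)]
    proof (rule INF_greatest)
      fix r assume "r \<in> {r. P.awalk (x, h) r (z, w)}"
      then have "P.awalk (x, h) r (z, w)" by simp
      from awalk_cartesian_product_project[OF assms this] obtain p q
        where pq: "G.awalk x p z" "H.awalk h q w" "length p + length q = length r" .
      have "gdist G x z + gdist H h w \<le> ereal (length p) + ereal (length q)"
        using pq wf by (intro add_mono gdist_le_length)
      also have "\<dots> = ereal (length r)" by (simp flip: pq(3))
      finally show "gdist G x z + gdist H h w \<le> ereal (real (length r))" .
    qed
  qed
qed

text \<open>Both distances to \<open>(z, w)\<close> contain the summand \<open>gdist H h w\<close>,
  so equal distances to \<open>z\<close> in \<open>G\<close> stay equal in the product. Nothing is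
  cancelled, hence infinite values do no harm.\<close>

lemma resolving_set_cartesian_product_subset:
  assumes "pair_graph G" "pair_graph H"
  shows "resolving_set (cartesian_product G H) (x, h) (y, h) \<subseteq> resolving_set G x y \<times> pverts H"
  by (auto simp: resolving_set_def gdist_cartesian_product[OF assms])

text \<open>Fibre sums may exceed 1, while a resolving function takes values in [0,1]. Cutting off
  is safe: either one term reaches 1 and suffices alone, or no term changes.\<close>

lemma one_le_sum_min_one:
  fixes f :: "'a \<Rightarrow> real"
  assumes "finite A" "\<And>a. a \<in> A \<Longrightarrow> 0 \<le> f a" "1 \<le> sum f A"
  shows "1 \<le> (\<Sum>a\<in>A. min 1 (f a))"
proof (cases "\<exists>a\<in>A. 1 \<le> f a")
  case True
  then obtain a where "a \<in> A" "min 1 (f a) = 1" by auto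
  with member_le_sum[of a A "\<lambda>a. min 1 (f a)"] assms show ?thesis by simp
next
  case False
  then have "(\<Sum>a\<in>A. min 1 (f a)) = sum f A" by (intro sum.cong) auto
  with assms(3) show ?thesis by simp
qed

lemma resolving_function_fibre_sum:
  assumes "pair_graph G" "pair_graph H" "pverts H \<noteq> {}"
    and "resolving_function (cartesian_product G H) f"
  shows "resolving_function G (\<lambda>u. min 1 (\<Sum>v\<in>pverts H. f (u, v)))"
proof -
  interpret G: pair_graph G by fact
  interpret H: pair_graph H by fact
  have f_nonneg: "0 \<le> f (u, v)" if "u \<in> pverts G" "v \<in> pverts H" for u v
    using assms(4) that by (auto simp: resolving_function_def Pi_iff)
  then have s_nonneg: "0 \<le> (\<Sum>v\<in>pverts H. f (u, v))" if "u \<in> pverts G" for u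
    using that by (intro sum_nonneg) auto
  obtain h where h: "h \<in> pverts H" using assms(3) by blast
  have "1 \<le> (\<Sum>z\<in>resolving_set G x y. min 1 (\<Sum>v\<in>pverts H. f (z, v)))"
    if "x \<in> pverts G" "y \<in> pverts G" "x \<noteq> y" for x y
  proof (rule one_le_sum_min_one)
    let ?R = "resolving_set (cartesian_product G H) (x, h) (y, h)"
    have sub: "resolving_set G x y \<subseteq> pverts G" by (auto simp: resolving_set_def)
    then show fin: "finite (resolving_set G x y)" by (rule finite_subset) simp
    show "0 \<le> (\<Sum>v\<in>pverts H. f (z, v))" if "z \<in> resolving_set G x y" for z
      using sub that by (intro s_nonneg) auto
    \<comment> \<open>As \<open>x \<noteq> y\<close>, the vertices \<open>(x, h)\<close> and
      \<open>(y, h)\<close> of the product are distinct, whichever \<open>h\<close> was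
      chosen.\<close>
    have "1 \<le> sum f ?R"
      using assms(4) that h by (auto simp: resolving_function_def)
    also have "\<dots> \<le> sum f (resolving_set G x y \<times> pverts H)"
      using fin sub f_nonneg
      by (intro sum_mono2 resolving_set_cartesian_product_subset assms) auto
    finally show "1 \<le> (\<Sum>z\<in>resolving_set G x y. \<Sum>v\<in>pverts H. f (z, v))"
      by (simp add: sum.cartesian_product)
  qed
  with s_nonneg show ?thesis by (auto simp: resolving_function_def)
qed

theorem theorem4p1:
  fixes G :: "'a pair_pre_digraph" and H :: "'b pair_pre_digraph"
  assumes "pair_graph G" and "Digraph_Component.connected (with_proj G)"
    and "pair_graph H" and "Digraph_Component.connected (with_proj H)"
  shows "fractional_metric_dimension (cartesian_product G H) \<ge> fractional_metric_dimension G"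
proof -
  \<comment> \<open>Connectedness includes having a vertex; this supplies the layer in which pairs
    of vertices of \<open>G\<close> are compared.\<close>
  have ne: "pverts H \<noteq> {}"
    using assms(4) by (auto simp: connected_def strongly_connected_def)
  obtain f where f: "resolving_function (cartesian_product G H) f"
    "fractional_metric_dimension (cartesian_product G H)
      = (\<Sum>p\<in>pverts (cartesian_product G H). f p)"
    using fractional_metric_dimension_attained[OF pair_graph_cartesian_product[OF assms(1,3)]]
    by metis
  have "fractional_metric_dimension G \<le> (\<Sum>u\<in>pverts G. min 1 (\<Sum>v\<in>pverts H. f (u, v)))"
    using fractional_metric_dimension_attained[OF assms(1)]
      resolving_function_fibre_sum[OF assms(1,3) ne f(1)] by metis
  also have "\<dots> \<le> (\<Sum>u\<in>pverts G. \<Sum>v\<in>pverts H. f (u, v))"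
    by (intro sum_mono) simp
  also have "\<dots> = fractional_metric_dimension (cartesian_product G H)"
    unfolding f(2) by (simp add: sum.cartesian_product)
  finally show ?thesis .
qed

end
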